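(* The following equalities hold: (1) $\operatorname{add}(\mathfrak{B},\mathfrak{D}_{\mathrm{fin}})=\operatorname{add}(\mathfrak{B},\mathfrak{D})=\mathfrak{d}$; (2) $\operatorname{add}(\mathfrak{D}_{\mathrm{fin}},\mathfrak{D}_{\mathrm{fin}})=\operatorname{add}(\mathfrak{X},\mathfrak{X})=\operatorname{add}(\mathfrak{X},\mathfrak{D}_{\mathrm{fin}})=2$; (3) $\operatorname{add}(\mathfrak{D},\mathfrak{D})=\operatorname{add}(\mathfrak{B},\mathfrak{B})=\operatorname{add}(\mathfrak{B},\mathfrak{X})=\mathfrak{b}$.
   Context: $\mathbb{N}^{\mathbb{N}}$ is the set of functions $\mathbb{N}\to\mathbb{N}$; $f\le^* g$ means $f(n)\le g(n)$ for all but finitely many $n$. A subset of $\mathbb{N}^{\mathbb{N}}$ is bounded if it has a $\le^*$-upper bound, and dominating if it is cofinal in $(\mathbb{N}^{\mathbb{N}},\le^* )$. $\mathfrak{b}$ ($\mathfrak{d}$) is the minimal size of an unbounded (dominating) subset of $\mathbb{N}^{\mathbb{N}}$. For finite $F\subseteq\mathbb{N}^{\mathbb{N}}$, $\max(F)(n)=\max\{f(n):f\in F\}$; $Y\subseteq\mathbb{N}^{\mathbb{N}}$ is finitely dominating if $\{\max(F): F\subseteq Y\text{ finite}\}$ is dominating. For $f,g$, $[f<g]=\{n:f(n)<g(n)\}$. For $Y\subseteq\mathbb{N}^{\mathbb{N}}$, $g\in\mathbb{N}^{\mathbb{N}}$ avoids middles in $Y$ (w.r.t. $\langle<,\le\rangle$)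 if $[f<g]$ is infinite for each $f\in Y$, and for all $f,h\in Y$ at least one of $\{n: f(n)<g(n)\le h(n)\}$, $\{n: h(n)<g(n)\le f(n)\}$ is finite. Classes: $\mathfrak{B}$ = bounded subsets of $\mathbb{N}^{\mathbb{N}}$; $\mathfrak{X}$ = subsets $Y$ for which some $g$ avoids middles in $Y$; $\mathfrak{D}_{\mathrm{fin}}$ = subsets which are not finitely dominating; $\mathfrak{D}$ = subsets which are not dominating. For classes $\mathfrak{I}\subseteq\mathfrak{J}$ of subsets of $\mathbb{N}^{\mathbb{N}}$, $\operatorname{add}(\mathfrak{I},\mathfrak{J})=\min\{|\mathcal{F}|:\mathcal{F}\subseteq\mathfrak{I},\ \bigcup\mathcal{F}\notin\mathfrak{J}\}$, and $\operatorname{add}(\mathfrak{J})=\operatorname{add}(\mathfrak{J},\mathfrak{J})$. *)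

theory Defs
  imports Main "HOL-Library.Infinite_Set"
begin

unbundle cardinal_syntax

definition le_star :: "(nat \<Rightarrow> nat) \<Rightarrow> (nat \<Rightarrow> nat) \<Rightarrow> bool" (infix "\<le>*" 50)
  where "f \<le>* g \<longleftrightarrow> (\<forall>\<^sub>\<infinity>n. f n \<le> g n)"

definition bounded_family :: "(nat \<Rightarrow> nat) set \<Rightarrow> bool"
  where "bounded_family Y \<longleftrightarrow> (\<exists>g. \<forall>f\<in>Y. f \<le>* g)"

definition dominating :: "(nat \<Rightarrow> nat) set \<Rightarrow> bool"
  where "dominating Y \<longleftrightarrow> (\<forall>g. \<exists>f\<in>Y. g \<le>* f)"

definition max_fun :: "(nat \<Rightarrow> nat) set \<Rightarrow> nat \<Rightarrow> nat"
  where "max_fun F n = Max ((\<lambda>f. f n) ` F)"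

text \<open>Only nonempty finite subsets are used, since a pointwise maximum over the empty set is
  not defined.\<close>

definition finitely_dominating :: "(nat \<Rightarrow> nat) set \<Rightarrow> bool"
  where "finitely_dominating Y \<longleftrightarrow>
    dominating {max_fun F | F. F \<subseteq> Y \<and> finite F \<and> F \<noteq> {}}"

definition avoids_middles :: "(nat \<Rightarrow> nat) \<Rightarrow> (nat \<Rightarrow> nat) set \<Rightarrow> bool"
  where "avoids_middles g Y \<longleftrightarrow>
    (\<forall>f\<in>Y. infinite {n. f n < g n}) \<and>
    (\<forall>f\<in>Y. \<forall>h\<in>Y. finite {n. f n < g n \<and> g n \<le> h n} \<or>
                  finite {n. h n < g n \<and> g n \<le> f n})"

definition \<BB> :: "(nat \<Rightarrow> nat) set set"
  where "\<BB> = {Y. bounded_family Y}"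

definition \<XX> :: "(nat \<Rightarrow> nat) set set"
  where "\<XX> = {Y. \<exists>g. avoids_middles g Y}"

definition \<DD>_fin :: "(nat \<Rightarrow> nat) set set"
  where "\<DD>_fin = {Y. \<not> finitely_dominating Y}"

definition \<DD> :: "(nat \<Rightarrow> nat) set set"
  where "\<DD> = {Y. \<not> dominating Y}"

text \<open>The least cardinality of a member of \<open>S\<close>.  Cardinals are represented by cardinal orders, so
  this is determined only up to \<open>=o\<close>, and it is meaningful only for nonempty \<open>S\<close>.\<close>

definition min_card :: "'a set set \<Rightarrow> 'a rel"
  where "min_card S = |SOME A. A \<in> S \<and> (\<forall>B\<in>S. |A| \<le>o |B| )|"

lemma min_card_exists:
  assumes "S \<noteq> {}"
  shows "\<exists>A\<in>S. min_card S = |A| \<and> (\<forall>B\<in>S. |A| \<le>o |B| )"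
proof -
  have "\<exists>r\<in>card_of ` S. \<forall>r'\<in>card_of ` S. r \<le>o r'"
    using assms by (intro exists_minim_Card_order) (auto simp: card_of_Card_order)
  then have "\<exists>A. A \<in> S \<and> (\<forall>B\<in>S. |A| \<le>o |B| )"
    by blast
  from someI_ex[OF this] show ?thesis
    unfolding min_card_def by blast
qed

definition \<bb> :: "(nat \<Rightarrow> nat) rel"
  where "\<bb> = min_card {Y. \<not> bounded_family Y}"

definition \<dd> :: "(nat \<Rightarrow> nat) rel"
  where "\<dd> = min_card {Y. dominating Y}"

definition add :: "'a set set \<Rightarrow> 'a set set \<Rightarrow> 'a set rel"
  where "add I J = min_card {F. F \<subseteq> I \<and> \<Union>F \<notin> J}"

text \<open>The collections whose minimal cardinality is taken are never empty.\<close>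

lemma unbounded_nonempty: "{Y. \<not> bounded_family Y} \<noteq> {}"
proof -
  have "\<not> bounded_family UNIV"
  proof
    assume "bounded_family UNIV"
    then obtain g where "(\<lambda>n. Suc (g n)) \<le>* g"
      unfolding bounded_family_def by blast
    then show False by (simp add: le_star_def)
  qed
  then show ?thesis by blast
qed

lemma le_star_refl: "f \<le>* f"
  by (simp add: le_star_def)

lemma dominating_UNIV: "dominating UNIV"
  unfolding dominating_def using le_star_refl by blast

lemma dominating_nonempty: "{Y. dominating Y} \<noteq> {}"
  using dominating_UNIV by blast

lemma add_nonempty:
  assumes "\<And>x. {x} \<in> I" and "UNIV \<notin> J"
  shows "{F. F \<subseteq> I \<and> \<Union>F \<notin> J} \<noteq> {}"
proof -
  have "range (\<lambda>x. {x}) \<subseteq> I" "\<Union> (range (\<lambda>x. {x})) \<notin> J"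
    using assms by auto
  then show ?thesis by blast
qed

lemma max_fun_singleton: "max_fun {f} = f"
  by (simp add: max_fun_def fun_eq_iff)

lemma singleton_classes: "{f} \<in> \<BB>" "{f} \<in> \<XX>" "{f} \<in> \<DD>_fin" "{f} \<in> \<DD>"
proof -
  show "{f} \<in> \<BB>"
    using le_star_refl by (auto simp: \<BB>_def bounded_family_def)
  show "{f} \<in> \<XX>"
    by (auto simp: \<XX>_def avoids_middles_def intro!: exI[of _ "\<lambda>n. Suc (f n)"])
  have not_dom: "\<not> dominating {f}"
  proof
    assume "dominating {f}"
    then have "(\<lambda>n. Suc (f n)) \<le>* f"
      unfolding dominating_def by blast
    then show False by (simp add: le_star_def)
  qed
  then show "{f} \<in> \<DD>" by (simp add: \<DD>_def)
  have "{max_fun F | F. F \<subseteq> {f} \<and> finite F \<and> F \<noteq> {}} = {f}"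
  proof (intro equalityI subsetI)
    fix h assume "h \<in> {f}"
    then have "h = max_fun {f}" by (simp add: max_fun_singleton)
    then show "h \<in> {max_fun F | F. F \<subseteq> {f} \<and> finite F \<and> F \<noteq> {}}" by blast
  qed (auto simp: subset_singleton_iff max_fun_singleton)
  with not_dom show "{f} \<in> \<DD>_fin" by (simp add: \<DD>_fin_def finitely_dominating_def)
qed

lemma UNIV_not_in_classes: "UNIV \<notin> \<BB>" "UNIV \<notin> \<XX>" "UNIV \<notin> \<DD>_fin" "UNIV \<notin> \<DD>"
proof -
  show "UNIV \<notin> \<DD>" by (simp add: \<DD>_def dominating_UNIV)
  have "{max_fun F | F. F \<subseteq> UNIV \<and> finite F \<and> F \<noteq> {}} = UNIV"
  proof -
    have "h = max_fun {h} \<and> {h} \<subseteq> UNIV \<and> finite {h} \<and> {h} \<noteq> {}" for h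
      by (simp add: max_fun_singleton)
    then show ?thesis by blast
  qed
  then show "UNIV \<notin> \<DD>_fin"
    by (simp add: \<DD>_fin_def finitely_dominating_def dominating_UNIV)
  show "UNIV \<notin> \<BB>"
  proof
    assume "UNIV \<in> \<BB>"
    then obtain g where "(\<lambda>n. Suc (g n)) \<le>* g"
      unfolding \<BB>_def bounded_family_def by blast
    then show False by (simp add: le_star_def)
  qed
  show "UNIV \<notin> \<XX>"
  proof
    assume "UNIV \<in> \<XX>"
    then obtain g where "avoids_middles g UNIV"
      unfolding \<XX>_def by (elim CollectE exE)
    then have "\<forall>f\<in>UNIV. infinite {n. f n < g n}"
      unfolding avoids_middles_def by (rule conjunct1)
    then have "infinite {n. g n < g n}" by (rule bspec) simp
    then show False by simp
  qed
qed

end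

(*
  Choosing a bound (or a witness of non-domination) for each member of a family turns a bad union
  into an unbounded or dominating set that is no larger; conversely, an unbounded or dominating set
  is the union of its singletons.  For D_fin it is the finite maxima of the bounds that dominate, and
  since a dominating set is infinite there are no more of them than bounds.  For add(D, D) <= b take
  an unbounded B: no f is above every member of B, so the sets of all f not above b (for b in B),
  none of them dominating, cover everything.

  For add(B, X) <= b take an unbounded B of nondecreasing functions and all functions below some
  member of B.  If g avoided middles in this set, then either all b in B are almost everywhere below g on
  the infinite set where g > 0, whence B is bounded by monotonicity, or 0 < g <= b holds infinitely often for some
  b; zeroing b on either half of that infinite set gives two functions whose middles are infinite.

  For the value 2, split the natural numbers into two infinite sets: the functions vanishing on one
  half and those vanishing on the other both lie in X, but maxima of one of each give all functions.
*)
theory Submission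
  imports Defs
begin

section \<open>Comparing minimal cardinalities\<close>

lemma min_card_le:
  assumes "B \<in> S"
  shows "min_card S \<le>o |B|"
  using min_card_exists[of S] assms by force

lemma min_card_ge:
  assumes "S \<noteq> {}" "\<And>B. B \<in> S \<Longrightarrow> r \<le>o |B|"
  shows "r \<le>o min_card S"
  using min_card_exists[OF assms(1)] assms(2) by force

lemma min_card_mono:
  assumes "S \<noteq> {}" "\<And>A. A \<in> S \<Longrightarrow> \<exists>B\<in>T. |B| \<le>o |A|"
  shows "min_card T \<le>o min_card S"
proof (rule min_card_ge[OF assms(1)])
  fix A assume "A \<in> S"
  then obtain B where "B \<in> T" "|B| \<le>o |A|" using assms(2) by blast
  then show "min_card T \<le>o |A|" using min_card_le ordLeq_transitive by blast
qed

lemma add_le: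
  assumes "F \<subseteq> I" "\<Union>F \<notin> J"
  shows "add I J \<le>o |F|"
  unfolding add_def using assms by (intro min_card_le) simp

text \<open>A larger target class leaves fewer families whose union escapes it. The hypotheses on
  singletons and \<open>UNIV\<close> ensure that such families remain, so both minima are
  meaningful.\<close>

lemma add_mono_right:
  assumes "J \<subseteq> J'" "\<And>x. {x} \<in> I" "UNIV \<notin> J'"
  shows "add I J \<le>o add I J'"
  unfolding add_def
proof (intro min_card_mono add_nonempty)
  fix F assume "F \<in> {F. F \<subseteq> I \<and> \<Union>F \<notin> J'}"
  then have "F \<in> {F. F \<subseteq> I \<and> \<Union>F \<notin> J}" using assms(1) by blast
  then show "\<exists>B\<in>{F. F \<subseteq> I \<and> \<Union>F \<notin> J}. |B| \<le>o |F|"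
    using card_of_mono1 by blast
qed (use assms in auto)

lemma add_le_min_card:
  assumes "S \<noteq> {}" "\<And>A. A \<in> S \<Longrightarrow> \<exists>f. f ` A \<subseteq> I \<and> \<Union>(f ` A) \<notin> J"
  shows "add I J \<le>o min_card S"
  unfolding add_def
proof (rule min_card_mono[OF assms(1)])
  fix A assume "A \<in> S"
  then obtain f where "f ` A \<subseteq> I \<and> \<Union>(f ` A) \<notin> J" using assms(2) by blast
  then show "\<exists>B\<in>{F. F \<subseteq> I \<and> \<Union>F \<notin> J}. |B| \<le>o |A|"
    using card_of_image by blast
qed

lemma min_card_le_add:
  assumes "\<And>x. {x} \<in> I" "UNIV \<notin> J"
    and "\<And>F. F \<subseteq> I \<Longrightarrow> \<Union>F \<notin> J \<Longrightarrow> \<exists>B\<in>S. |B| \<le>o |F|"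
  shows "min_card S \<le>o add I J"
  unfolding add_def using assms by (intro min_card_mono add_nonempty) auto

text \<open>One set cannot escape \<open>J\<close>, because \<open>I \<subseteq> J\<close>, and the
  empty family has union \<open>{}\<close>. So two sets are necessary, and \<open>A\<close> and
  \<open>B\<close> suffice.\<close>

lemma add_eq_two:
  assumes "I \<subseteq> J" "{} \<in> J" "A \<in> I" "B \<in> I" "A \<union> B \<notin> J"
  shows "add I J =o |{..<2::nat}|"
proof -
  have "add I J \<le>o |{A, B}|" using assms by (intro add_le) auto
  moreover have "|{A, B}| \<le>o |{..<2::nat}|"
    by (rule surj_imp_ordLeq[where f = "\<lambda>n. if n = 0 then A else B"])
      (auto simp: lessThan_Suc numeral_2_eq_2)
  moreover have "|{..<2::nat}| \<le>o add I J"
    unfolding add_def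
  proof (rule min_card_ge)
    show "{F. F \<subseteq> I \<and> \<Union>F \<notin> J} \<noteq> {}"
      using assms by (auto intro!: exI[of _ "{A, B}"])
    fix F assume "F \<in> {F. F \<subseteq> I \<and> \<Union>F \<notin> J}"
    then have F: "F \<subseteq> I" "\<Union>F \<notin> J" by simp_all
    then obtain X where "X \<in> F" using assms(2) by fastforce
    moreover have "F \<noteq> {X}"
    proof
      assume "F = {X}"
      then have "\<Union>F = X" by simp
      then show False using F \<open>X \<in> F\<close> assms(1) by blast
    qed
    ultimately obtain Y where "Y \<in> F" "Y \<noteq> X" by blast
    then have "inj_on (\<lambda>n::nat. if n = 0 then X else Y) {..<2}"
      "(\<lambda>n::nat. if n = 0 then X else Y) ` {..<2} \<subseteq> F"
      using \<open>X \<in> F\<close> by (auto simp: inj_on_def)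
    then show "|{..<2::nat}| \<le>o |F|" using card_of_ordLeq by blast
  qed
  ultimately show ?thesis by (meson ordIso_iff_ordLeq ordLeq_transitive)
qed

text \<open>Sort the finite subsets by size. Each set of size \<open>Suc n\<close> arises by
  inserting a point into one of size \<open>n\<close>, so every level embeds in \<open>A\<close> by
  absorption of infinite products, and there are only countably many levels.\<close>

lemma card_of_Fpow_ordLeq:
  assumes "infinite A"
  shows "|Fpow A| \<le>o |A|"
proof -
  define S where "S n = {F. F \<subseteq> A \<and> finite F \<and> card F = n}" for n
  have "|S n| \<le>o |A|" for n
  proof (induction n)
    case 0
    have "S 0 = {{}}" by (auto simp: S_def)
    then show ?case using assms by (auto intro!: card_of_singl_ordLeq)
  next
    case (Suc n)
    have "S (Suc n) \<subseteq> (\<lambda>(a, F). insert a F) ` (A \<times> S n)"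
    proof
      fix F assume F: "F \<in> S (Suc n)"
      then obtain a G where "F = insert a G" "a \<notin> G" "card G = n" "finite G"
        by (auto simp: S_def card_Suc_eq_finite)
      then show "F \<in> (\<lambda>(a, F). insert a F) ` (A \<times> S n)"
        using F by (auto simp: S_def)
    qed
    then have "|S (Suc n)| \<le>o |A \<times> S n|" by (rule surj_imp_ordLeq)
    also have "|A \<times> S n| \<le>o |A|"
      using assms Suc
      by (intro card_of_Times_ordLeq_infinite_Field)
        (simp_all add: Field_card_of card_of_card_order_on card_of_mono1)
    finally show ?case .
  qed
  then have "|\<Union>n\<in>UNIV. S n| \<le>o |A|"
    using assms by (intro card_of_UNION_ordLeq_infinite) (auto simp: infinite_iff_card_of_nat[symmetric])
  moreover have "Fpow A = (\<Union>n\<in>UNIV. S n)" by (auto simp: Fpow_def S_def)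
  ultimately show ?thesis by simp
qed

section \<open>Relations between the classes\<close>

lemma le_star_trans: "f \<le>* g \<Longrightarrow> g \<le>* h \<Longrightarrow> f \<le>* h"
  unfolding le_star_def by (auto elim: eventually_elim2)

lemma not_Suc_le_star: "\<not> (\<lambda>n. Suc (g n)) \<le>* g"
  by (simp add: le_star_def)

lemma not_le_star_iff: "\<not> f \<le>* g \<longleftrightarrow> infinite {n. g n < f n}"
  by (simp add: le_star_def not_le MOST_iff_cofinite)

lemma bounded_family_not_dominating:
  assumes "bounded_family Y"
  shows "\<not> dominating Y"
proof
  assume "dominating Y"
  obtain g where g: "\<And>f. f \<in> Y \<Longrightarrow> f \<le>* g"
    using assms unfolding bounded_family_def by blast
  obtain f where "f \<in> Y" "(\<lambda>n. Suc (g n)) \<le>* f"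
    using \<open>dominating Y\<close> unfolding dominating_def by blast
  then show False using g le_star_trans not_Suc_le_star by blast
qed

text \<open>If \<open>g\<close> is an almost everywhere bound, its successor is almost everywhere
  strictly above each member, which makes every middle finite.\<close>

lemma BB_subset_XX: "\<BB> \<subseteq> \<XX>"
proof
  fix Y assume "Y \<in> \<BB>"
  then obtain g where g: "\<And>f. f \<in> Y \<Longrightarrow> finite {n. \<not> f n \<le> g n}"
    unfolding \<BB>_def bounded_family_def le_star_def MOST_iff_cofinite by blast
  have "infinite {n. f n < Suc (g n)}" if "f \<in> Y" for f
  proof
    assume "finite {n. f n < Suc (g n)}"
    then have "finite ({n. f n < Suc (g n)} \<union> {n. \<not> f n \<le> g n})" using g that by blast
    moreover have "{n. f n < Suc (g n)} \<union> {n. \<not> f n \<le> g n} = UNIV" by auto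
    ultimately show False by simp
  qed
  moreover have "finite {n. f n < Suc (g n) \<and> Suc (g n) \<le> h n}" if "h \<in> Y" for f h
    by (rule finite_subset[OF _ g[OF that]]) auto
  ultimately have "avoids_middles (\<lambda>n. Suc (g n)) Y" unfolding avoids_middles_def by blast
  then show "Y \<in> \<XX>" unfolding \<XX>_def by blast
qed

text \<open>Avoiding middles says that the sets \<open>[f < g]\<close> form a chain modulo finite sets, so a finite
  nonempty family of them has an almost least member.\<close>

lemma avoids_middles_least:
  assumes "finite F" "F \<noteq> {}" "F \<subseteq> Y" "avoids_middles g Y"
  shows "\<exists>f\<in>F. \<forall>h\<in>F. finite {n. f n < g n \<and> g n \<le> h n}"
  using assms(1-3)
proof (induction rule: finite_ne_induct)
  case (singleton x)
  have *: "{n. x n < g n \<and> g n \<le> x n} = {}" by auto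
  show ?case by (simp only: * bex_simps ball_simps finite.emptyI simp_thms)
next
  case (insert x F)
  then have "F \<subseteq> Y" "x \<in> Y" by auto
  then obtain f where f: "f \<in> F" "\<And>h. h \<in> F \<Longrightarrow> finite {n. f n < g n \<and> g n \<le> h n}"
    using insert.IH by blast
  consider "finite {n. f n < g n \<and> g n \<le> x n}" | "finite {n. x n < g n \<and> g n \<le> f n}"
    using assms(4) \<open>F \<subseteq> Y\<close> \<open>x \<in> Y\<close> f(1) unfolding avoids_middles_def by blast
  then show ?case
  proof cases
    case 1
    then show ?thesis using f by blast
  next
    case 2
    \<comment> \<open>Here \<open>x\<close> takes over as least member: where
      \<open>x < g \<le> h\<close>, either \<open>g \<le> f\<close> or \<open>f < g \<le> h\<close>,
      and both happen only finitely often.\<close>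
    have "finite {n. x n < g n \<and> g n \<le> h n}" if "h \<in> F" for h
      by (rule finite_subset[OF _ finite_UnI[OF 2 f(2)[OF that]]]) auto
    moreover have *: "{n. x n < g n \<and> g n \<le> x n} = {}" by auto
    have "finite {n. x n < g n \<and> g n \<le> x n}" unfolding * by (rule finite.emptyI)
    ultimately show ?thesis by blast
  qed
qed

text \<open>The function \<open>g\<close> that avoids middles is itself not dominated by finite
  maxima: on almost all of the infinite set \<open>[f < g]\<close> of an almost least
  \<open>f\<close>, every other member of \<open>F\<close> is below \<open>g\<close> too.\<close>

lemma XX_subset_DD_fin: "\<XX> \<subseteq> \<DD>_fin"
proof
  fix Y assume "Y \<in> \<XX>"
  then obtain g where g: "avoids_middles g Y" unfolding \<XX>_def by blast
  have "\<not> g \<le>* max_fun F" if F: "F \<subseteq> Y" "finite F" "F \<noteq> {}" for F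
  proof -
    obtain f where f: "f \<in> F" "\<And>h. h \<in> F \<Longrightarrow> finite {n. f n < g n \<and> g n \<le> h n}"
      using avoids_middles_least[OF F(2,3,1) g] by blast
    have "infinite {n. f n < g n}"
      using g f(1) F(1) unfolding avoids_middles_def by blast
    moreover have "finite (\<Union>h\<in>F. {n. f n < g n \<and> g n \<le> h n})"
      using F(2) f(2) by blast
    moreover have "{n. f n < g n}
        \<subseteq> (\<Union>h\<in>F. {n. f n < g n \<and> g n \<le> h n}) \<union> {n. max_fun F n < g n}"
      using F by (auto simp: max_fun_def not_le)
    ultimately show ?thesis
      unfolding not_le_star_iff by (meson finite_UnI finite_subset)
  qed
  then show "Y \<in> \<DD>_fin"
    unfolding \<DD>_fin_def finitely_dominating_def dominating_def by blast
qed

lemma DD_fin_subset_DD: "\<DD>_fin \<subseteq> \<DD>"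
proof
  fix Y assume "Y \<in> \<DD>_fin"
  then obtain g where g: "\<And>F. F \<subseteq> Y \<Longrightarrow> finite F \<Longrightarrow> F \<noteq> {} \<Longrightarrow> \<not> g \<le>* max_fun F"
    unfolding \<DD>_fin_def finitely_dominating_def dominating_def by blast
  have "\<not> g \<le>* f" if "f \<in> Y" for f
    using g[of "{f}"] that by (simp add: max_fun_singleton)
  then show "Y \<in> \<DD>" unfolding \<DD>_def dominating_def by blast
qed

section \<open>Additivity numbers equal to 2\<close>

lemma vanishing_in_XX:
  assumes "infinite S"
  shows "{f. \<forall>n\<in>S. f n = 0} \<in> \<XX>"
proof -
  \<comment> \<open>With the indicator of \<open>S\<close>, the set \<open>[f < g]\<close> is
    exactly \<open>S\<close> for every \<open>f\<close> in the family, so all middles are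
    empty.\<close>
  define g :: "nat \<Rightarrow> nat" where "g n = (if n \<in> S then 1 else 0)" for n
  have "{n. f n < g n} = S" if "\<forall>n\<in>S. f n = 0" for f
    using that by (auto simp: g_def split: if_splits)
  then have "infinite {n. f n < g n}" if "\<forall>n\<in>S. f n = 0" for f
    using that assms by simp
  moreover have "{n. f n < g n \<and> g n \<le> h n} = {}" if "\<forall>n\<in>S. h n = 0" for f h
    using that by (auto simp: g_def split: if_splits)
  then have "finite {n. f n < g n \<and> g n \<le> h n}" if "\<forall>n\<in>S. h n = 0" for f h
    using that by (metis finite.emptyI)
  ultimately have "avoids_middles g {f. \<forall>n\<in>S. f n = 0}"
    unfolding avoids_middles_def by blast
  then show ?thesis unfolding \<XX>_def by blast
qed

lemma vanishing_Un_finitely_dominating: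
  "finitely_dominating ({f. \<forall>n\<in>S. f n = 0} \<union> {f. \<forall>n\<in>-S. f n = 0})"
  unfolding finitely_dominating_def dominating_def
proof
  fix g :: "nat \<Rightarrow> nat"
  define p where "p n = (if n \<in> S then 0 else g n)" for n
  define q where "q n = (if n \<in> S then g n else 0)" for n
  have "max_fun {p, q} = g" by (auto simp: max_fun_def p_def q_def)
  moreover have "{p, q} \<subseteq> {f. \<forall>n\<in>S. f n = 0} \<union> {f. \<forall>n\<in>-S. f n = 0}"
    by (auto simp: p_def q_def)
  ultimately have "g \<in> {max_fun F |F. F \<subseteq> {f. \<forall>n\<in>S. f n = 0} \<union> {f. \<forall>n\<in>-S. f n = 0}
      \<and> finite F \<and> F \<noteq> {}}"
    by (metis (mono_tags, lifting) CollectI finite.emptyI finite.insertI insert_not_empty)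
  then show "\<exists>f\<in>{max_fun F |F. F \<subseteq> {f. \<forall>n\<in>S. f n = 0} \<union> {f. \<forall>n\<in>-S. f n = 0}
      \<and> finite F \<and> F \<noteq> {}}. g \<le>* f"
    using le_star_refl by blast
qed

text \<open>The two vanishing families lie in the smallest class and their union escapes the largest
  one, so a single argument serves all three pairs of classes.\<close>

lemma add_eq_two_between:
  assumes "\<XX> \<subseteq> I" "I \<subseteq> J" "J \<subseteq> \<DD>_fin"
  shows "add I J =o |{..<2::nat}|"
proof -
  obtain S :: "nat set" where S: "infinite S" "infinite (- S)"
    using infinite_split[of "UNIV :: nat set"]
    by (metis Compl_eq_Diff_UNIV Diff_eq finite_subset disjoint_eq_subset_Compl infinite_UNIV_nat)
  have "avoids_middles g {}" for g by (simp add: avoids_middles_def)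
  then have "{} \<in> \<XX>" unfolding \<XX>_def by blast
  then show ?thesis
    using add_eq_two[of I J "{f. \<forall>n\<in>S. f n = 0}" "{f. \<forall>n\<in>-S. f n = 0}"]
      vanishing_in_XX[OF S(1)] vanishing_in_XX[OF S(2)] vanishing_Un_finitely_dominating assms
    unfolding \<DD>_fin_def by blast
qed

section \<open>Additivity numbers equal to the dominating number\<close>

lemma dd_le_add_BB_DD_fin: "\<dd> \<le>o add \<BB> \<DD>_fin"
  unfolding \<dd>_def
proof (rule min_card_le_add[OF singleton_classes(1) UNIV_not_in_classes(3)])
  fix F assume "F \<subseteq> \<BB>" "\<Union>F \<notin> \<DD>_fin"
  then have F: "finitely_dominating (\<Union>F)" by (simp add: \<DD>_fin_def)
  have "\<forall>Y\<in>F. \<exists>g. \<forall>f\<in>Y. f \<le>* g"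
    using \<open>F \<subseteq> \<BB>\<close> unfolding \<BB>_def bounded_family_def by blast
  then obtain b where b: "\<And>Y f. Y \<in> F \<Longrightarrow> f \<in> Y \<Longrightarrow> f \<le>* b Y" by metis
  \<comment> \<open>The empty \<open>G\<close> contributes only one function with an unspecified
    constant value; an extra member does not harm domination.\<close>
  define D where "D = (\<lambda>G n. Max ((\<lambda>Y. b Y n) ` G)) ` Fpow F"
  have "dominating D"
    unfolding dominating_def
  proof
    fix g :: "nat \<Rightarrow> nat"
    obtain E where E: "E \<subseteq> \<Union>F" "finite E" "E \<noteq> {}" "g \<le>* max_fun E"
      using F unfolding finitely_dominating_def dominating_def by blast
    have "\<forall>f\<in>E. \<exists>Y. Y \<in> F \<and> f \<in> Y" using E(1) by blast
    then obtain y where y: "\<And>f. f \<in> E \<Longrightarrow> y f \<in> F \<and> f \<in> y f"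
      using bchoice[of E "\<lambda>f Y. Y \<in> F \<and> f \<in> Y"] by blast
    have "\<forall>f\<in>E. \<forall>\<^sub>\<infinity>n. f n \<le> b (y f) n"
      using y b unfolding le_star_def by blast
    \<comment> \<open>Since \<open>E\<close> is finite, the finitely many exceptional sets can be
      discarded at once.\<close>
    then have "\<forall>\<^sub>\<infinity>n. \<forall>f\<in>E. f n \<le> b (y f) n"
      using E(2) by (simp add: MOST_finite_Ball_distrib)
    then have "max_fun E \<le>* (\<lambda>n. Max ((\<lambda>Y. b Y n) ` y ` E))"
      unfolding le_star_def
    proof (rule eventually_mono)
      fix n assume "\<forall>f\<in>E. f n \<le> b (y f) n"
      then have "f n \<le> Max ((\<lambda>Y. b Y n) ` y ` E)" if "f \<in> E" for f
        using E(2) that by (intro order_trans[OF _ Max_ge[of _ "b (y f) n"]]) auto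
      then show "max_fun E n \<le> Max ((\<lambda>Y. b Y n) ` y ` E)"
        using E(2,3) by (simp add: max_fun_def)
    qed
    moreover have "y ` E \<in> Fpow F" using y E(2) by (auto simp: Fpow_def)
    ultimately show "\<exists>f\<in>D. g \<le>* f"
      using E(4) le_star_trans unfolding D_def by blast
  qed
  \<comment> \<open>Otherwise \<open>D\<close> would be finite and hence bounded by its own maximum.
    Infinity is what the count of finite subfamilies requires.\<close>
  have "infinite F"
  proof
    assume "finite F"
    then have "finite D" by (simp add: D_def Fpow_def)
    then have "f \<le>* max_fun D" if "f \<in> D" for f
      using that by (simp add: le_star_def max_fun_def)
    then show False
      using \<open>dominating D\<close> bounded_family_not_dominating unfolding bounded_family_def by blast
  qed
  then have "|D| \<le>o |F|"
    unfolding D_def using card_of_image card_of_Fpow_ordLeq ordLeq_transitive by blast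
  then show "\<exists>D\<in>{Y. dominating Y}. |D| \<le>o |F|" using \<open>dominating D\<close> by blast
qed

lemma add_BB_DD_le_dd: "add \<BB> \<DD> \<le>o \<dd>"
  unfolding \<dd>_def
proof (rule add_le_min_card[OF dominating_nonempty])
  fix A assume "A \<in> {Y. dominating Y}"
  then show "\<exists>f. f ` A \<subseteq> \<BB> \<and> \<Union>(f ` A) \<notin> \<DD>"
    using singleton_classes(1) by (intro exI[of _ "\<lambda>x. {x}"]) (auto simp: \<DD>_def)
qed

section \<open>Additivity numbers equal to the bounding number\<close>

lemma bb_le_add_BB_BB: "\<bb> \<le>o add \<BB> \<BB>"
  unfolding \<bb>_def
proof (rule min_card_le_add[OF singleton_classes(1) UNIV_not_in_classes(1)])
  fix F assume "F \<subseteq> \<BB>" "\<Union>F \<notin> \<BB>"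
  have "\<forall>Y\<in>F. \<exists>g. \<forall>f\<in>Y. f \<le>* g"
    using \<open>F \<subseteq> \<BB>\<close> unfolding \<BB>_def bounded_family_def by blast
  then obtain b where b: "\<And>Y f. Y \<in> F \<Longrightarrow> f \<in> Y \<Longrightarrow> f \<le>* b Y" by metis
  have "\<not> bounded_family (b ` F)"
  proof
    assume "bounded_family (b ` F)"
    then obtain g where "\<And>Y. Y \<in> F \<Longrightarrow> b Y \<le>* g" unfolding bounded_family_def by blast
    then have "\<forall>f\<in>\<Union>F. f \<le>* g" using b le_star_trans by blast
    then show False using \<open>\<Union>F \<notin> \<BB>\<close> unfolding \<BB>_def bounded_family_def by blast
  qed
  then show "\<exists>B\<in>{Y. \<not> bounded_family Y}. |B| \<le>o |F|" using card_of_image by blast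
qed

text \<open>A common bound \<open>g\<close> of the witnesses \<open>b Y\<close> would be a witness
  for the whole union: if some \<open>f\<close> in \<open>Y\<close> were above \<open>g\<close>, it
  would be above \<open>b Y\<close>.\<close>

lemma bb_le_add_DD_DD: "\<bb> \<le>o add \<DD> \<DD>"
  unfolding \<bb>_def
proof (rule min_card_le_add[OF singleton_classes(4) UNIV_not_in_classes(4)])
  fix F assume "F \<subseteq> \<DD>" "\<Union>F \<notin> \<DD>"
  have "\<forall>Y\<in>F. \<exists>g. \<forall>f\<in>Y. \<not> g \<le>* f"
    using \<open>F \<subseteq> \<DD>\<close> unfolding \<DD>_def dominating_def by blast
  then obtain b where b: "\<And>Y f. Y \<in> F \<Longrightarrow> f \<in> Y \<Longrightarrow> \<not> b Y \<le>* f" by metis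
  have "\<not> bounded_family (b ` F)"
  proof
    assume "bounded_family (b ` F)"
    then obtain g where "\<And>Y. Y \<in> F \<Longrightarrow> b Y \<le>* g" unfolding bounded_family_def by blast
    then have "\<forall>f\<in>\<Union>F. \<not> g \<le>* f" using b le_star_trans by blast
    then show False using \<open>\<Union>F \<notin> \<DD>\<close> unfolding \<DD>_def dominating_def by blast
  qed
  then show "\<exists>B\<in>{Y. \<not> bounded_family Y}. |B| \<le>o |F|" using card_of_image by blast
qed

lemma add_DD_DD_le_bb: "add \<DD> \<DD> \<le>o \<bb>"
  unfolding \<bb>_def
proof (rule add_le_min_card[OF unbounded_nonempty])
  fix B assume "B \<in> {Y. \<not> bounded_family Y}"
  then have "(\<Union>b\<in>B. {f. \<not> b \<le>* f}) = UNIV" unfolding bounded_family_def by blast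
  moreover have "{f. \<not> b \<le>* f} \<in> \<DD>" for b unfolding \<DD>_def dominating_def by blast
  ultimately show "\<exists>y. y ` B \<subseteq> \<DD> \<and> \<Union>(y ` B) \<notin> \<DD>"
    using UNIV_not_in_classes(4) by (intro exI[of _ "\<lambda>b. {f. \<not> b \<le>* f}"]) auto
qed

text \<open>Monotonicity carries a bound on \<open>S\<close> to all arguments: move \<open>n\<close>
  up to a point \<open>s n\<close> of \<open>S\<close>; then
  \<open>b n \<le> b (s n) < g (s n)\<close> for large \<open>n\<close>.\<close>

lemma mono_bounded_on_infinite:
  assumes "\<And>b. b \<in> B \<Longrightarrow> mono b" "infinite S" "\<And>b. b \<in> B \<Longrightarrow> finite {n\<in>S. g n \<le> b n}"
  shows "bounded_family B"
proof -
  have "\<forall>n. \<exists>m\<ge>n. m \<in> S" using assms(2) by (simp add: infinite_nat_iff_unbounded_le)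
  then obtain s where s: "\<And>n. s n \<ge> n" "\<And>n. s n \<in> S" by metis
  have "b \<le>* (\<lambda>n. g (s n))" if "b \<in> B" for b
  proof -
    obtain k where k: "{n\<in>S. g n \<le> b n} \<subseteq> {..<k}"
      using assms(3)[OF \<open>b \<in> B\<close>] finite_nat_bounded by blast
    have "b n \<le> g (s n)" if "n \<ge> k" for n
    proof -
      have "\<not> g (s n) \<le> b (s n)" using k s[of n] that by force
      moreover have "b n \<le> b (s n)" using assms(1)[OF \<open>b \<in> B\<close>] s(1) by (simp add: monoD)
      ultimately show ?thesis by simp
    qed
    then show ?thesis unfolding le_star_def MOST_nat_le by blast
  qed
  then show ?thesis unfolding bounded_family_def by blast
qed

lemma downset_not_in_XX:
  assumes "\<And>b. b \<in> B \<Longrightarrow> mono b" "\<not> bounded_family B"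
  shows "(\<Union>b\<in>B. {f. f \<le>* b}) \<notin> \<XX>"
proof
  let ?Y = "\<Union>b\<in>B. {f. f \<le>* b}"
  assume "?Y \<in> \<XX>"
  then obtain g where g: "avoids_middles g ?Y" unfolding \<XX>_def by blast
  have below: "f \<in> ?Y" if "b \<in> B" "\<And>n. f n \<le> b n" for f b
    using that by (auto simp: le_star_def intro!: bexI[of _ b])
  obtain b where "b \<in> B" using assms(2) by (auto simp: bounded_family_def)
  \<comment> \<open>The zero function forces \<open>g\<close> to be positive infinitely
    often.\<close>
  then have "(\<lambda>n. 0) \<in> ?Y" by (rule below) simp
  moreover have "infinite {n. f n < g n}" if "f \<in> ?Y" for f
    using g that unfolding avoids_middles_def by blast
  ultimately have "infinite {n. 0 < g n}" by blast
  then obtain b where b: "b \<in> B" "infinite {n \<in> {n. 0 < g n}. g n \<le> b n}"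
    using mono_bounded_on_infinite[of B "{n. 0 < g n}" g] assms by blast
  obtain S T where ST: "S \<subseteq> {n \<in> {n. 0 < g n}. g n \<le> b n}" "T \<subseteq> {n \<in> {n. 0 < g n}. g n \<le> b n}"
      "infinite S" "infinite T" "S \<inter> T = {}"
    by (rule infinite_split[OF b(2)])
  \<comment> \<open>On \<open>S\<close> one has \<open>p S = 0 < g \<le> b = p T\<close>, and on
    \<open>T\<close> the roles are exchanged, so both middles are infinite.\<close>
  define p where "p U n = (if n \<in> U then 0 else b n)" for U n
  have "p U \<in> ?Y" for U using b(1) by (intro below[of b]) (auto simp: p_def)
  moreover have "finite {n. f n < g n \<and> g n \<le> h n} \<or> finite {n. h n < g n \<and> g n \<le> f n}"
    if "f \<in> ?Y" "h \<in> ?Y" for f h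
    using g that unfolding avoids_middles_def by blast
  ultimately have "finite {n. p S n < g n \<and> g n \<le> p T n} \<or> finite {n. p T n < g n \<and> g n \<le> p S n}"
    by simp
  moreover have "S \<subseteq> {n. p S n < g n \<and> g n \<le> p T n}" "T \<subseteq> {n. p T n < g n \<and> g n \<le> p S n}"
    using ST(1,2,5) by (auto simp: p_def)
  ultimately show False using ST(3,4) finite_subset by blast
qed

lemma add_BB_XX_le_bb: "add \<BB> \<XX> \<le>o \<bb>"
  unfolding \<bb>_def
proof (rule add_le_min_card[OF unbounded_nonempty])
  fix B assume B: "B \<in> {Y. \<not> bounded_family Y}"
  \<comment> \<open>The running maximum is nondecreasing and above \<open>b\<close>, so it keeps the
    family unbounded without enlarging its cardinality.\<close>
  define c :: "(nat \<Rightarrow> nat) \<Rightarrow> nat \<Rightarrow> nat" where "c b n = Max (b ` {..n})" for b n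
  have "mono (c b)" for b
    unfolding c_def by (intro monoI Max_mono) auto
  moreover have "\<not> bounded_family (c ` B)"
  proof
    assume "bounded_family (c ` B)"
    then obtain g where "\<And>b. b \<in> B \<Longrightarrow> c b \<le>* g" unfolding bounded_family_def by blast
    moreover have "b \<le>* c b" for b by (simp add: le_star_def c_def)
    ultimately show False using B le_star_trans unfolding bounded_family_def by blast
  qed
  ultimately have "(\<Union>b\<in>c ` B. {f. f \<le>* b}) \<notin> \<XX>" by (intro downset_not_in_XX) auto
  moreover have "{f. f \<le>* b} \<in> \<BB>" for b unfolding \<BB>_def bounded_family_def by blast
  ultimately show "\<exists>y. y ` B \<subseteq> \<BB> \<and> \<Union>(y ` B) \<notin> \<XX>"
    by (intro exI[of _ "\<lambda>b. {f. f \<le>* c b}"]) auto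
qed

theorem theorem4p1:
  shows
    "(add \<BB> \<DD>_fin =o add \<BB> \<DD> \<and> add \<BB> \<DD> =o \<dd>) \<and>
     (add \<DD>_fin \<DD>_fin =o add \<XX> \<XX> \<and> add \<XX> \<XX> =o add \<XX> \<DD>_fin \<and>
      add \<XX> \<DD>_fin =o |{..<2::nat}| ) \<and>
     (add \<DD> \<DD> =o add \<BB> \<BB> \<and> add \<BB> \<BB> =o add \<BB> \<XX> \<and> add \<BB> \<XX> =o \<bb>)"
proof (intro conjI)
  have "add \<BB> \<DD>_fin \<le>o add \<BB> \<DD>"
    by (rule add_mono_right[OF DD_fin_subset_DD singleton_classes(1) UNIV_not_in_classes(4)])
  then show "add \<BB> \<DD>_fin =o add \<BB> \<DD>" "add \<BB> \<DD> =o \<dd>"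
    using dd_le_add_BB_DD_fin add_BB_DD_le_dd by (meson ordIso_iff_ordLeq ordLeq_transitive)+
  have "add \<DD>_fin \<DD>_fin =o |{..<2::nat}|" "add \<XX> \<XX> =o |{..<2::nat}|"
    and 2: "add \<XX> \<DD>_fin =o |{..<2::nat}|"
    using XX_subset_DD_fin by (auto intro: add_eq_two_between)
  then show "add \<DD>_fin \<DD>_fin =o add \<XX> \<XX>" "add \<XX> \<XX> =o add \<XX> \<DD>_fin"
    by (meson ordIso_symmetric ordIso_transitive)+
  show "add \<XX> \<DD>_fin =o |{..<2::nat}|" by (rule 2)
  \<comment> \<open>This closes the cycle from \<open>\<bb>\<close> through
    \<open>add \<BB> \<BB>\<close> and \<open>add \<BB> \<XX>\<close> back to
    \<open>\<bb>\<close>.\<close>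
  have "add \<BB> \<BB> \<le>o add \<BB> \<XX>"
    by (rule add_mono_right[OF BB_subset_XX singleton_classes(1) UNIV_not_in_classes(2)])
  then show "add \<DD> \<DD> =o add \<BB> \<BB>" "add \<BB> \<BB> =o add \<BB> \<XX>" "add \<BB> \<XX> =o \<bb>"
    using bb_le_add_BB_BB bb_le_add_DD_DD add_DD_DD_le_bb add_BB_XX_le_bb
    by (meson ordIso_iff_ordLeq ordLeq_transitive)+
qed

end
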